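(* Let $X,Y$ be separable Hilbert spaces, let $(X_N)_{N\in\mathbb{N}_0}$ be a nested family of subspaces of $X$ with orthogonal projectors $P_N:X\to X_N$, and let $T_N:X_N\to Y$ be linear operators with (i) $\|T_N\|\le 1$, (ii) $T_Nx_M=T_Mx_M$ for all $N\ge M$ and $x_M\in X_M$, (iii) $\mathcal{R}(T_N^* )\subseteq X_N$. Let $y\in Y$ and assume that there exist $N_*\in\mathbb{N}_0$ and $x_*\in X_{N_*}$ with $T_{N_*}x_*=y$, and that $T_{N_*}$ is continuously invertible. Let $\eta>0$ and $\tau>1$. Suppose that $y^\delta\in Y$ fulfills $\|y^\delta-y\|\le\delta$, that in the multi-level CGNE algorithm the iteration at level $N$ is stopped according to the discrepancy principle $$\|T_Nx_{k,N}^\delta-y^\delta\|^2>2(1+\eta)\left(\delta+\|P_Nx_*-x_*\|\right)\|y^\delta\|\quad\text{for }0\le k\le k_*(N,\delta),$$ and that the multi-level iteration is terminated when for the first time $$\|T_Nx_{k,N}^\delta-y^\delta\|^2\le 2(1+\eta)\tau\delta\|y^\delta\|.$$ Denote by $N(\delta)$ the level and by $K_*(N(\delta),\delta)$ the iteration index at which this termination occurs. Then $$x_{K_*(N(\delta),\delta),N(\delta)}^\delta\to x_*\qquad\text{as }\delta\to 0.$$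
   Context: Nested means $X_N\subseteq X_{N+1}$ for all $N$. CGNE at level $N$ for data $y^\delta$ with starting element $x_0\in X_N$ (write $T=T_N$): set $r_0=w_0=y^\delta-Tx_0$ and, for $k=0,1,2,\dots$, $d_k=T^*w_k$, $\alpha_k=\|T^*r_k\|^2/\|Td_k\|^2$, $x_{k+1}=x_k+\alpha_kd_k$, $r_{k+1}=r_k-\alpha_kTd_k$, $\beta_k=\|T^*r_{k+1}\|^2/\|T^*r_k\|^2$, $w_{k+1}=r_{k+1}+\beta_kw_k$. The iterates at level $N$ are denoted $x_{k,N}^\delta$ ($k$ iteration index, $N$ level). Multi-level CGNE algorithm (parameters $\eta>0$, $\tau>1$, noise level $\delta$, data $y^\delta$). Level $0$: given $x_{0,0}^\delta\in X_0$, consider the conditions (a) $\|T_0x_{0,0}^\delta-y^\delta\|^2>2(1+\eta)(\delta+\|P_0x_*-x_*\|)\|y^\delta\|$ and (b) $\|T_0x_{0,0}^\delta-y^\delta\|^2>2(1+\eta)\tau\delta\|y^\delta\|$. If (b) fails, $x_{0,0}^\delta$ is accepted as approximate solution and the algorithm terminates. If (b) holds and (a) fails, one chooses a level $J$ with $\|T_Jx_{0,0}^\delta-y^\delta\|^2>2(1+\eta)(\delta+\|P_Jx_*-x_*\|)\|y^\delta\|$ and renumbers the levels so that $J$ becomes level $0$. Then CGNE is run at level $0$ from $x_{0,0}^\delta$ until, for the first time, $\|T_0x_{k+1,0}^\delta-y^\delta\|^2\le 2(1+\eta)(\delta+\|P_0x_*-x_*\|)\|y^\delta\|$; this $k$ is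 denoted $k_*(0,\delta)$. From level $N$ to level $N+1$: unless the multi-level iteration has been terminated by $\|T_Nx_{k,N}^\delta-y^\delta\|^2\le 2(1+\eta)\tau\delta\|y^\delta\|$ (this includes the test of $x_{k_*(N,\delta)+1,N}^\delta$), set $x_{0,N+1}^\delta:=x_{k_*(N,\delta),N}^\delta$ and run CGNE at level $N+1$ from $x_{0,N+1}^\delta$ until, for the first time, $\|T_{N+1}x_{k+1,N+1}^\delta-y^\delta\|^2\le 2(1+\eta)(\delta+\|P_{N+1}x_*-x_*\|)\|y^\delta\|$; this $k$ is denoted $k_*(N+1,\delta)$.
   Formalization: The level J at which the algorithm starts after renumbering is required to satisfy J ≤ N_*; if J may exceed N_*, the operator at level J need not be injective and the iterates can converge to a different solution. *)

theory Defs
  imports "HOL-Analysis.Analysis"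
begin

text \<open>
  Operators \<open>S \<rightarrow> Y\<close> on a linear subspace \<open>S\<close> of the ambient space are total functions
  of which only the values on \<open>S\<close> are ever used.
\<close>

definition linear_on :: "'a::real_vector set \<Rightarrow> ('a \<Rightarrow> 'b::real_vector) \<Rightarrow> bool" where
  "linear_on S f \<longleftrightarrow>
     (\<forall>u\<in>S. \<forall>v\<in>S. f (u + v) = f u + f v) \<and> (\<forall>c. \<forall>u\<in>S. f (c *\<^sub>R u) = c *\<^sub>R f u)"

text \<open>
  As \<^const>\<open>onorm\<close>, but over a subspace; extended-real valued, so that an unbounded operator
  has norm \<open>\<infinity>\<close> instead of an unspecified real value.
\<close>

definition onorm_on :: "'a::real_normed_vector set \<Rightarrow> ('a \<Rightarrow> 'b::real_normed_vector) \<Rightarrow> ereal" where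
  "onorm_on S f = (SUP u\<in>S. ereal (norm (f u) / norm u))"

definition orthogonal_projector_onto :: "'a::real_inner set \<Rightarrow> ('a \<Rightarrow> 'a) \<Rightarrow> bool" where
  "orthogonal_projector_onto S p \<longleftrightarrow> (\<forall>u. p u \<in> S \<and> u - p u \<in> S\<^sup>\<bottom>)"

text \<open>
  The adjoint \<open>Y \<rightarrow> S\<close> of \<open>f : S \<rightarrow> Y\<close>, where \<open>S\<close> carries the inner product of the ambient
  space. The element described is unique for every subspace \<open>S\<close>, and it exists if \<open>S\<close> is closed
  in a Hilbert space and \<open>f\<close> is linear and bounded on \<open>S\<close>.
\<close>

definition adjoint_on :: "'a::real_inner set \<Rightarrow> ('a \<Rightarrow> 'b::real_inner) \<Rightarrow> 'b \<Rightarrow> 'a" where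
  "adjoint_on S f v = (THE z. z \<in> S \<and> (\<forall>u\<in>S. f u \<bullet> v = u \<bullet> z))"

text \<open>The inverse is considered on the range, which need not be the whole codomain.\<close>

definition continuously_invertible_on ::
    "'a::topological_space set \<Rightarrow> ('a \<Rightarrow> 'b::topological_space) \<Rightarrow> bool" where
  "continuously_invertible_on S f \<longleftrightarrow> inj_on f S \<and> continuous_on (f ` S) (inv_into S f)"

text \<open>
  The CGNE state \<open>(x\<^sub>k, r\<^sub>k, w\<^sub>k)\<close>. If \<open>T\<^sup>* r\<^sub>k = 0\<close>, so that \<open>x\<^sub>k\<close> already minimises the residual,
  the quotients become \<open>0 / 0 = 0\<close> and \<open>x\<^sub>k\<close>, \<open>r\<^sub>k\<close> stay constant from then on.
\<close>

primrec cgne_state :: "'a::real_inner set \<Rightarrow> ('a \<Rightarrow> 'b::real_inner) \<Rightarrow> 'b \<Rightarrow> 'a \<Rightarrow> nat \<Rightarrow> 'a \<times> 'b \<times> 'b"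
where
  "cgne_state S T yd x\<^sub>0 0 = (x\<^sub>0, yd - T x\<^sub>0, yd - T x\<^sub>0)"
| "cgne_state S T yd x\<^sub>0 (Suc k) =
    (let (x, r, w) = cgne_state S T yd x\<^sub>0 k;
         d = adjoint_on S T w;
         \<alpha> = (norm (adjoint_on S T r))\<^sup>2 / (norm (T d))\<^sup>2;
         x' = x + \<alpha> *\<^sub>R d;
         r' = r - \<alpha> *\<^sub>R T d;
         \<beta> = (norm (adjoint_on S T r'))\<^sup>2 / (norm (adjoint_on S T r))\<^sup>2
     in (x', r', r' + \<beta> *\<^sub>R w))"

definition cgne :: "'a::real_inner set \<Rightarrow> ('a \<Rightarrow> 'b::real_inner) \<Rightarrow> 'b \<Rightarrow> 'a \<Rightarrow> nat \<Rightarrow> 'a" where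
  "cgne S T yd x\<^sub>0 k = fst (cgne_state S T yd x\<^sub>0 k)"

definition discrepancy_bound ::
    "(nat \<Rightarrow> 'a::real_normed_vector \<Rightarrow> 'a) \<Rightarrow> 'a \<Rightarrow> real \<Rightarrow> real \<Rightarrow> 'b::real_normed_vector \<Rightarrow> nat \<Rightarrow> real"
where
  "discrepancy_bound P xs \<eta> \<delta> yd N = 2 * (1 + \<eta>) * (\<delta> + norm (P N xs - xs)) * norm yd"

definition termination_bound :: "real \<Rightarrow> real \<Rightarrow> real \<Rightarrow> 'b::real_normed_vector \<Rightarrow> real" where
  "termination_bound \<eta> \<tau> \<delta> yd = 2 * (1 + \<eta>) * \<tau> * \<delta> * norm yd"

text \<open>\<open>is_kstar X T P xs \<eta> \<delta> yd N x\<^sub>0 k\<close>: CGNE at level \<open>N\<close>, started at \<open>x\<^sub>0\<close>, has \<open>k\<^sub>*(N,\<delta>) = k\<close>.\<close>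

definition is_kstar ::
    "(nat \<Rightarrow> 'a::real_inner set) \<Rightarrow> (nat \<Rightarrow> 'a \<Rightarrow> 'b::real_inner) \<Rightarrow> (nat \<Rightarrow> 'a \<Rightarrow> 'a) \<Rightarrow> 'a \<Rightarrow>
     real \<Rightarrow> real \<Rightarrow> 'b \<Rightarrow> nat \<Rightarrow> 'a \<Rightarrow> nat \<Rightarrow> bool"
where
  "is_kstar X T P xs \<eta> \<delta> yd N x\<^sub>0 k \<longleftrightarrow>
     (\<forall>j\<le>k. (norm (T N (cgne (X N) (T N) yd x\<^sub>0 j) - yd))\<^sup>2 > discrepancy_bound P xs \<eta> \<delta> yd N) \<and>
     (norm (T N (cgne (X N) (T N) yd x\<^sub>0 (Suc k)) - yd))\<^sup>2 \<le> discrepancy_bound P xs \<eta> \<delta> yd N"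

text \<open>
  \<open>level_start X T P xs \<eta> \<tau> \<delta> yd x00 J N x\<^sub>0\<close>: the algorithm, whose first CGNE level is \<open>J\<close>, reaches
  level \<open>N\<close>, and CGNE is started there with \<open>x\<^sub>0\<close>. The levels keep their original numbers, so that
  the level which the algorithm renumbers to \<open>0\<close> is \<open>J\<close> here.
\<close>

inductive level_start ::
    "(nat \<Rightarrow> 'a::real_inner set) \<Rightarrow> (nat \<Rightarrow> 'a \<Rightarrow> 'b::real_inner) \<Rightarrow> (nat \<Rightarrow> 'a \<Rightarrow> 'a) \<Rightarrow> 'a \<Rightarrow>
     real \<Rightarrow> real \<Rightarrow> real \<Rightarrow> 'b \<Rightarrow> 'a \<Rightarrow> nat \<Rightarrow> nat \<Rightarrow> 'a \<Rightarrow> bool"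
  for X T P xs \<eta> \<tau> \<delta> yd x00 J
where
  first_level:
    "level_start X T P xs \<eta> \<tau> \<delta> yd x00 J J x00"
    if "(norm (T 0 x00 - yd))\<^sup>2 > termination_bound \<eta> \<tau> \<delta> yd"
      and "if (norm (T 0 x00 - yd))\<^sup>2 > discrepancy_bound P xs \<eta> \<delta> yd 0
           then J = 0
           else (norm (T J x00 - yd))\<^sup>2 > discrepancy_bound P xs \<eta> \<delta> yd J"
| next_level:
    "level_start X T P xs \<eta> \<tau> \<delta> yd x00 J (Suc N) (cgne (X N) (T N) yd x\<^sub>0 k)"
    if "level_start X T P xs \<eta> \<tau> \<delta> yd x00 J N x\<^sub>0"
      and "is_kstar X T P xs \<eta> \<delta> yd N x\<^sub>0 k"
      and "\<forall>j\<le>Suc k. (norm (T N (cgne (X N) (T N) yd x\<^sub>0 j) - yd))\<^sup>2 > termination_bound \<eta> \<tau> \<delta> yd"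

text \<open>
  \<open>ml_cgne_terminates X T P xs \<eta> \<tau> \<delta> yd x00 J N K x\<close>: the algorithm terminates at level \<open>N\<close> with
  iteration index \<open>K\<close>, and \<open>x\<close> is the iterate \<open>x\<^sub>K\<^sub>,\<^sub>N\<close>. In the rule \<open>terminate\<close> the lower bound by the
  discrepancy expresses that the \<open>K\<close>-th iterate is computed at level \<open>N\<close> at all,
  i.e. \<open>K \<le> k\<^sub>*(N,\<delta>) + 1\<close>.
\<close>

inductive ml_cgne_terminates ::
    "(nat \<Rightarrow> 'a::real_inner set) \<Rightarrow> (nat \<Rightarrow> 'a \<Rightarrow> 'b::real_inner) \<Rightarrow> (nat \<Rightarrow> 'a \<Rightarrow> 'a) \<Rightarrow> 'a \<Rightarrow>
     real \<Rightarrow> real \<Rightarrow> real \<Rightarrow> 'b \<Rightarrow> 'a \<Rightarrow> nat \<Rightarrow> nat \<Rightarrow> nat \<Rightarrow> 'a \<Rightarrow> bool"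
  for X T P xs \<eta> \<tau> \<delta> yd x00 J
where
  accept_initial:
    "ml_cgne_terminates X T P xs \<eta> \<tau> \<delta> yd x00 J 0 0 x00"
    if "(norm (T 0 x00 - yd))\<^sup>2 \<le> termination_bound \<eta> \<tau> \<delta> yd"
| terminate:
    "ml_cgne_terminates X T P xs \<eta> \<tau> \<delta> yd x00 J N K (cgne (X N) (T N) yd x\<^sub>0 K)"
    if "level_start X T P xs \<eta> \<tau> \<delta> yd x00 J N x\<^sub>0"
      and "\<forall>j<K. (norm (T N (cgne (X N) (T N) yd x\<^sub>0 j) - yd))\<^sup>2 > discrepancy_bound P xs \<eta> \<delta> yd N"
      and "\<forall>j<K. (norm (T N (cgne (X N) (T N) yd x\<^sub>0 j) - yd))\<^sup>2 > termination_bound \<eta> \<tau> \<delta> yd"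
      and "(norm (T N (cgne (X N) (T N) yd x\<^sub>0 K) - yd))\<^sup>2 \<le> termination_bound \<eta> \<tau> \<delta> yd"

end

theory Submission
  imports Defs
begin

text \<open>
  Since \<open>P N\<^sub>* x\<^sub>* = x\<^sub>*\<close>, at level \<open>N\<^sub>*\<close> the discrepancy bound lies below the termination
  bound (as \<open>\<tau> > 1\<close>), so the algorithm never gets past that level and the accepted iterate lies in
  \<open>X N\<^sub>*\<close>. Its residual tends to \<open>0\<close> with \<open>\<delta>\<close> by the termination test, and the continuity of the
  inverse of \<open>T N\<^sub>*\<close> at \<open>y\<close> turns this into convergence of the iterates.
\<close>

lemma orthogonal_projector_onto_fixes:
  assumes "orthogonal_projector_onto S p" "subspace S" "u \<in> S"
  shows "p u = u"
proof -
  have "u - p u \<in> S" "u - p u \<in> S\<^sup>\<bottom>"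
    using assms by (auto simp: orthogonal_projector_onto_def intro: subspace_diff)
  then have "(u - p u) \<bullet> (u - p u) = 0"
    by (auto simp: orthogonal_comp_def orthogonal_def)
  then show ?thesis by simp
qed

text \<open>Each step adds a multiple of a search direction \<open>adjoint_on S T w\<close>, and the
  range condition puts every such direction in \<open>S\<close>.\<close>

lemma cgne_in_subspace:
  assumes "subspace S" "range (adjoint_on S T) \<subseteq> S" "x\<^sub>0 \<in> S"
  shows "cgne S T yd x\<^sub>0 k \<in> S"
proof (induction k)
  case 0
  then show ?case using assms by (simp add: cgne_def)
next
  case (Suc k)
  obtain x r w where state: "cgne_state S T yd x\<^sub>0 k = (x, r, w)"
    by (metis prod_cases3)
  have "adjoint_on S T w \<in> S" "x \<in> S"
    using assms Suc state by (auto simp: cgne_def)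
  then show ?case
    using assms(1) state by (auto simp: cgne_def Let_def intro: subspace_add subspace_scale)
qed

lemma discrepancy_bound_le_termination_bound:
  assumes "P N xs = xs" "\<eta> > 0" "\<tau> \<ge> 1" "\<delta> \<ge> 0"
  shows "discrepancy_bound P xs \<eta> \<delta> yd N \<le> termination_bound \<eta> \<tau> \<delta> yd"
proof -
  have "\<delta> \<le> \<tau> * \<delta>" using assms mult_right_mono[of 1 \<tau> \<delta>] by simp
  then have "2 * (1 + \<eta>) * \<delta> * norm yd \<le> 2 * (1 + \<eta>) * (\<tau> * \<delta>) * norm yd"
    using assms by (intro mult_right_mono mult_left_mono) auto
  then show ?thesis
    using assms by (simp add: discrepancy_bound_def termination_bound_def mult.assoc)
qed

text \<open>Leaving a level requires an iterate that meets the discrepancy bound there but still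
  exceeds the termination bound; at \<open>Nstar\<close>, \<open>bound\<close> excludes this.
  \<open>J \<le> Nstar\<close> starts the induction.\<close>

lemma level_start_bounded:
  assumes start: "level_start X T P xs \<eta> \<tau> \<delta> yd x00 J N x\<^sub>0"
    and bound: "discrepancy_bound P xs \<eta> \<delta> yd Nstar \<le> termination_bound \<eta> \<tau> \<delta> yd"
    and "J \<le> Nstar"
  shows "N \<le> Nstar"
  using start
proof induction
  case first_level
  then show ?case using \<open>J \<le> Nstar\<close> by simp
next
  case (next_level N x\<^sub>0 k)
  \<comment> \<open>The contradiction comes from index \<open>Suc k\<close> alone: the iterates up
    to \<open>k\<close> exceed both bounds. Hence it matters that the termination test also covers
    the iterate after the one handed over.\<close>
  have "N \<noteq> Nstar"
    using next_level.hyps(2,3) bound unfolding is_kstar_def by fastforce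
  then show ?case using next_level.IH by simp
qed

lemma level_start_in_subspace:
  assumes start: "level_start X T P xs \<eta> \<tau> \<delta> yd x00 J N x\<^sub>0"
    and sub: "\<And>N. subspace (X N)" and nested: "\<And>N. X N \<subseteq> X (Suc N)"
    and adj: "\<And>N. range (adjoint_on (X N) (T N)) \<subseteq> X N"
    and "x00 \<in> X 0"
  shows "x\<^sub>0 \<in> X N"
  using start
proof induction
  case first_level
  \<comment> \<open>The first CGNE level is \<open>J\<close>, while the initial element is given in
    \<open>X 0\<close>; nestedness bridges the gap.\<close>
  show ?case using lift_Suc_mono_le[of X 0 J, OF nested] \<open>x00 \<in> X 0\<close> by auto
next
  case (next_level N x\<^sub>0 k)
  then show ?case using cgne_in_subspace[OF sub adj] nested by blast
qed

text \<open>These three facts are all that the convergence argument takes from the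
  algorithm.\<close>

lemma ml_cgne_terminates_residual:
  assumes "ml_cgne_terminates X T P xs \<eta> \<tau> \<delta> yd x00 J N K x"
    and sub: "\<And>N. subspace (X N)" and nested: "\<And>N. X N \<subseteq> X (Suc N)"
    and adj: "\<And>N. range (adjoint_on (X N) (T N)) \<subseteq> X N"
    and bound: "discrepancy_bound P xs \<eta> \<delta> yd Nstar \<le> termination_bound \<eta> \<tau> \<delta> yd"
    and x00: "x00 \<in> X 0" and J: "J \<le> Nstar"
  shows "N \<le> Nstar" "x \<in> X N" "(norm (T N x - yd))\<^sup>2 \<le> termination_bound \<eta> \<tau> \<delta> yd"
  using assms(1)
proof (atomize(full), cases)
  case accept_initial
  then show "N \<le> Nstar \<and> x \<in> X N \<and> (norm (T N x - yd))\<^sup>2 \<le> termination_bound \<eta> \<tau> \<delta> yd"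
    using x00 by simp
next
  case (terminate x\<^sub>0)
  then show "N \<le> Nstar \<and> x \<in> X N \<and> (norm (T N x - yd))\<^sup>2 \<le> termination_bound \<eta> \<tau> \<delta> yd"
    using level_start_bounded[OF _ bound J] cgne_in_subspace[OF sub adj]
      level_start_in_subspace[OF _ sub nested adj x00]
    by blast
qed

lemma tendsto_of_continuously_invertible_on:
  assumes inv: "continuously_invertible_on S f" and "a \<in> S"
    and ev: "eventually (\<lambda>t. x t \<in> S) F" and lim: "((\<lambda>t. f (x t)) \<longlongrightarrow> f a) F"
  shows "(x \<longlongrightarrow> a) F"
proof -
  have "((\<lambda>t. inv_into S f (f (x t))) \<longlongrightarrow> inv_into S f (f a)) F"
    using inv \<open>a \<in> S\<close> ev unfolding continuously_invertible_on_def
    by (intro continuous_on_tendsto_compose[OF _ lim]) (auto elim: eventually_mono)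
  moreover have "inv_into S f (f a) = a"
    using inv \<open>a \<in> S\<close> by (simp add: continuously_invertible_on_def)
  moreover have "eventually (\<lambda>t. inv_into S f (f (x t)) = x t) F"
    using ev by eventually_elim (use inv in \<open>simp add: continuously_invertible_on_def\<close>)
  ultimately show ?thesis by (simp add: tendsto_cong)
qed

theorem theorem2p7:
  fixes X :: "nat \<Rightarrow> 'a::{real_inner, banach} set"
    and P :: "nat \<Rightarrow> 'a \<Rightarrow> 'a"
    and T :: "nat \<Rightarrow> 'a \<Rightarrow> 'b::{real_inner, banach}"
    and y :: 'b and xs :: 'a and Nstar :: nat
    and \<eta> \<tau> \<delta>\<^sub>0 :: real
    and yd :: "real \<Rightarrow> 'b" and x00 :: "real \<Rightarrow> 'a"
    and J Nd Kd :: "real \<Rightarrow> nat" and xd :: "real \<Rightarrow> 'a"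
  assumes "separable_space (euclidean :: 'a topology)"
    and "separable_space (euclidean :: 'b topology)"
    and "\<And>N. subspace (X N)"
    and "\<And>N. X N \<subseteq> X (Suc N)"
    and "\<And>N. orthogonal_projector_onto (X N) (P N)"
    and "\<And>N. linear_on (X N) (T N)"
    and "\<And>N. onorm_on (X N) (T N) \<le> 1"
    and "\<And>M N u. M \<le> N \<Longrightarrow> u \<in> X M \<Longrightarrow> T N u = T M u"
    and "\<And>N. range (adjoint_on (X N) (T N)) \<subseteq> X N"
    and "xs \<in> X Nstar" and "T Nstar xs = y"
    and "continuously_invertible_on (X Nstar) (T Nstar)"
    and "\<eta> > 0" and "\<tau> > 1" and "\<delta>\<^sub>0 > 0"
    and "\<And>\<delta>. 0 < \<delta> \<Longrightarrow> \<delta> < \<delta>\<^sub>0 \<Longrightarrow> norm (yd \<delta> - y) \<le> \<delta>"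
    and "\<And>\<delta>. 0 < \<delta> \<Longrightarrow> \<delta> < \<delta>\<^sub>0 \<Longrightarrow> x00 \<delta> \<in> X 0"
    and "\<And>\<delta>. 0 < \<delta> \<Longrightarrow> \<delta> < \<delta>\<^sub>0 \<Longrightarrow> J \<delta> \<le> Nstar"
    and "\<And>\<delta>. 0 < \<delta> \<Longrightarrow> \<delta> < \<delta>\<^sub>0 \<Longrightarrow>
           ml_cgne_terminates X T P xs \<eta> \<tau> \<delta> (yd \<delta>) (x00 \<delta>) (J \<delta>) (Nd \<delta>) (Kd \<delta>) (xd \<delta>)"
  shows "(xd \<longlongrightarrow> xs) (at_right 0)"
proof -
  note sub = assms(3) and nested = assms(4) and proj = assms(5) and consistent = assms(8)
    and adj = assms(9) and xs = assms(10) and Txs = assms(11) and inv = assms(12)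
    and \<eta> = assms(13) and \<tau> = assms(14) and \<delta>\<^sub>0 = assms(15) and noise = assms(16)
    and x00 = assms(17) and J = assms(18) and run = assms(19)
  \<comment> \<open>The root bounds the residual against the noisy data, with
    \<open>norm (yd \<delta>)\<close> replaced by \<open>norm y + \<delta>\<close> so that the bound
    depends on \<delta> alone; the last \<delta> pays for passing from \<open>yd \<delta>\<close> to
    \<open>y\<close>.\<close>
  define \<rho> where "\<rho> \<delta> = sqrt (2 * (1 + \<eta>) * \<tau> * \<delta> * (norm y + \<delta>)) + \<delta>" for \<delta>
  have residual: "xd \<delta> \<in> X Nstar \<and> norm (T Nstar (xd \<delta>) - y) \<le> \<rho> \<delta>"
    if \<delta>: "0 < \<delta>" "\<delta> < \<delta>\<^sub>0" for \<delta>
  proof -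
    have "discrepancy_bound P xs \<eta> \<delta> (yd \<delta>) Nstar \<le> termination_bound \<eta> \<tau> \<delta> (yd \<delta>)"
      using orthogonal_projector_onto_fixes[OF proj sub xs] \<eta> \<tau> \<delta>
      by (intro discrepancy_bound_le_termination_bound) auto
    note res = ml_cgne_terminates_residual[OF run[OF \<delta>] sub nested adj this x00[OF \<delta>] J[OF \<delta>]]
    have "norm (yd \<delta>) \<le> norm y + \<delta>"
      using noise[OF \<delta>] norm_triangle_sub[of "yd \<delta>" y] by linarith
    then have "termination_bound \<eta> \<tau> \<delta> (yd \<delta>) \<le> 2 * (1 + \<eta>) * \<tau> * \<delta> * (norm y + \<delta>)"
      unfolding termination_bound_def using \<eta> \<tau> \<delta> by (intro mult_left_mono) auto
    then have "norm (T (Nd \<delta>) (xd \<delta>) - yd \<delta>) \<le> sqrt (2 * (1 + \<eta>) * \<tau> * \<delta> * (norm y + \<delta>))"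
      using res(3) by (intro real_le_rsqrt) linarith
    then have "norm (T (Nd \<delta>) (xd \<delta>) - y) \<le> \<rho> \<delta>"
      using noise[OF \<delta>] norm_triangle_ineq[of "T (Nd \<delta>) (xd \<delta>) - yd \<delta>" "yd \<delta> - y"]
      by (simp add: \<rho>_def)
    \<comment> \<open>The final level \<open>Nd \<delta>\<close> varies with \<delta>. Nestedness
      and consistency of the operators move iterate and residual to the fixed level
      \<open>Nstar\<close>, where the inverse is available.\<close>
    moreover have "xd \<delta> \<in> X Nstar"
      using lift_Suc_mono_le[of X, OF nested res(1)] res(2) by blast
    ultimately show ?thesis
      using consistent[OF res(1,2)] by simp
  qed
  have near: "eventually (\<lambda>\<delta>. 0 < \<delta> \<and> \<delta> < \<delta>\<^sub>0) (at_right 0)"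
    using \<delta>\<^sub>0 by (auto simp: eventually_at_right_field)
  \<comment> \<open>The limit is \<rho> evaluated at \<delta> = 0, where the factor \<delta> under
    the root vanishes.\<close>
  have "(\<rho> \<longlongrightarrow> sqrt (2 * (1 + \<eta>) * \<tau> * 0 * (norm y + 0)) + 0) (at_right 0)"
    unfolding \<rho>_def by (intro tendsto_intros)
  then have "(\<rho> \<longlongrightarrow> 0) (at_right 0)" by simp
  then have "((\<lambda>\<delta>. T Nstar (xd \<delta>) - y) \<longlongrightarrow> 0) (at_right 0)"
    by (rule Lim_null_comparison[rotated]) (use near residual in \<open>auto elim: eventually_mono\<close>)
  then have "((\<lambda>\<delta>. T Nstar (xd \<delta>)) \<longlongrightarrow> T Nstar xs) (at_right 0)"
    unfolding Txs by (rule LIM_zero_cancel)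
  then show ?thesis
    by (rule tendsto_of_continuously_invertible_on[OF inv xs, rotated])
      (use near residual in \<open>auto elim: eventually_mono\<close>)
qed

end
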